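(* Let $\mathbb{E}$ be an embedding of the graph $G$, and let $v=(s_v,\pi_v)_q$ be a vertex of $G$ (so $v$ is incident to $q$ faces of $\mathbb{E}$), with $D_v=s_v\circ\pi_v^{-1}$. Then for any integer $\Delta g$ with $$-\left\lfloor\frac{deg(v)+1-\ell(\lambda(D_v))-q}{2}\right\rfloor\le \Delta g\le \left\lfloor\frac{q-1}{2}\right\rfloor$$ there exists an embedding $\mathbb{E}'$ of $G$ such that $g(\mathbb{E}')=g(\mathbb{E})+\Delta g$. In particular, if there is a vertex $v$ of $G$ which is incident to every face of $\mathbb{E}$, then $G$ is upper embeddable.
   Context: Graphs are finite and connected with at least one edge, loops and multiple edges allowed. An embedding is a 2-cell embedding on a closed orientable surface. Permutations are composed right to left, and fixed points count as cycles. An embedding $\mathbb{E}$ of $G$ with $e$ edges is encoded by a triple $(\alpha,\beta,\gamma)$ of permutations of the set $[2e]$ of half edges (each edge consists of two half edges): $\alpha$ is the fixed-point-free involution pairing the two half edges of each edge; the cycles of $\beta$ are the vertices, each cycle listing the half edges incident to that vertex in counterclockwise cyclic order; $\gamma=\alpha\beta$, and its cycles are the faces. Write $s=\gamma$, $\pi=\beta$. The genus $g=g(\mathbb{E})$ is given by $(\#\text{vertices})-(\#\text{edges})+(\#\text{faces})=2-2g$. For a vertex $v$, $H(v)$ is the set of half edges incident to $v$ and $deg(v)=|H(v)|$. A face is incident to $v$ if the corresponding cycle of $s$ contains an element of $H(v)$. If $v$ is incident to $q$ faces, then $(s_v,\pi_v)_q$ is the pair of permutations of $H(v)$ in which $s_v$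 (with $q$ cycles) is obtained from the $q$ cycles of $s$ incident to $v$ by deleting all elements not in $H(v)$, and $\pi_v$ is the restriction of $\pi$ to $H(v)$ (a single cycle). $\lambda(D_v)$ is the cycle-type of $D_v$ and $\ell(\lambda(D_v))$ its number of parts, i.e. the number of cycles of $D_v$ as a permutation of $H(v)$. $g_{max}(G)$ is the maximum genus of an embedding of $G$. $G$ is upper embeddable if $g_{max}(G)=\lfloor\beta(G)/2\rfloor$, where $\beta(G)=(\#\text{edges})-(\#\text{vertices})+1$. *)

theory Defs
  imports
    "Graph_Theory.Graph_Theory"
    "HOL-Combinatorics.Orbits"
    "HOL-Library.Multiset"
begin

text \<open>
  A finite undirected multigraph (loops and parallel edges allowed) is a bidirected digraph:
  its arcs are the half edges, the half edge \<open>a\<close> is incident to the vertex \<open>tail G a\<close>, and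
  \<open>arev\<close> exchanges the two half edges of an edge. A loop at \<open>v\<close> contributes two half edges
  with tail \<open>v\<close>. Hence \<open>out_arcs G v\<close> is the set $H(v)$ of half edges incident to \<open>v\<close>, and
  \<open>out_degree G v\<close> is the degree of \<open>v\<close>.
\<close>

locale multigraph = bidirected_digraph G arev + fin_digraph G
  for G :: "('a, 'h) pre_digraph" and arev :: "'h \<Rightarrow> 'h" +
  assumes connected: "Digraph_Component.connected G"
    and arcs_nonempty: "arcs G \<noteq> {}"

definition edges_of :: "('a, 'h) pre_digraph \<Rightarrow> ('h \<Rightarrow> 'h) \<Rightarrow> 'h set set" where
  "edges_of G arev = (\<lambda>a. {a, arev a}) ` arcs G"

definition betti :: "('a, 'h) pre_digraph \<Rightarrow> ('h \<Rightarrow> 'h) \<Rightarrow> int" where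
  "betti G arev = int (card (edges_of G arev)) - int (card (verts G)) + 1"

text \<open>The cycles of a permutation \<open>f\<close> of \<open>A\<close>, as sets; fixed points are cycles.\<close>

definition cycles_on :: "('h \<Rightarrow> 'h) \<Rightarrow> 'h set \<Rightarrow> 'h set set" where
  "cycles_on f A = orbit f ` A"

definition cycle_type_on :: "('h \<Rightarrow> 'h) \<Rightarrow> 'h set \<Rightarrow> nat multiset" where
  "cycle_type_on f A = image_mset card (mset_set (cycles_on f A))"

record 'h embedding =
  alpha :: "'h \<Rightarrow> 'h"
  beta :: "'h \<Rightarrow> 'h"
  gamma :: "'h \<Rightarrow> 'h"

text \<open>
  The permutations act on the half edges and are the identity elsewhere, so distinct triples
  are distinct as triples of permutations of \<open>arcs G\<close>.
\<close>

definition is_embedding ::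
  "('a, 'h) pre_digraph \<Rightarrow> ('h \<Rightarrow> 'h) \<Rightarrow> 'h embedding \<Rightarrow> bool" where
  "is_embedding G arev E \<longleftrightarrow>
     alpha E = arev \<and>
     beta E permutes arcs G \<and>
     cycles_on (beta E) (arcs G) = out_arcs G ` verts G \<and>
     gamma E = alpha E \<circ> beta E"

definition faces :: "('a, 'h) pre_digraph \<Rightarrow> 'h embedding \<Rightarrow> 'h set set" where
  "faces G E = cycles_on (gamma E) (arcs G)"

definition genus :: "('a, 'h) pre_digraph \<Rightarrow> ('h \<Rightarrow> 'h) \<Rightarrow> 'h embedding \<Rightarrow> int" where
  "genus G arev E =
     (THE g. int (card (verts G)) - int (card (edges_of G arev)) + int (card (faces G E))
        = 2 - 2 * g)"

definition max_genus :: "('a, 'h) pre_digraph \<Rightarrow> ('h \<Rightarrow> 'h) \<Rightarrow> int" where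
  "max_genus G arev = Max (genus G arev ` {E. is_embedding G arev E})"

definition upper_embeddable :: "('a, 'h) pre_digraph \<Rightarrow> ('h \<Rightarrow> 'h) \<Rightarrow> bool" where
  "upper_embeddable G arev \<longleftrightarrow> max_genus G arev = betti G arev div 2"

definition face_incident :: "('a, 'h) pre_digraph \<Rightarrow> 'h set \<Rightarrow> 'a \<Rightarrow> bool" where
  "face_incident G F v \<longleftrightarrow> F \<inter> out_arcs G v \<noteq> {}"

definition incident_faces :: "('a, 'h) pre_digraph \<Rightarrow> 'h embedding \<Rightarrow> 'a \<Rightarrow> 'h set set" where
  "incident_faces G E v = {F \<in> faces G E. face_incident G F v}"

text \<open>
  Deleting from the cycles of \<open>f\<close> all elements outside \<open>A\<close>: each element of \<open>A\<close> is sent to the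
  next element of \<open>A\<close> on its cycle.
\<close>

definition delete_outside :: "('h \<Rightarrow> 'h) \<Rightarrow> 'h set \<Rightarrow> 'h \<Rightarrow> 'h" where
  "delete_outside f A x =
     (if x \<in> A then (f ^^ (LEAST n. 0 < n \<and> (f ^^ n) x \<in> A)) x else x)"

definition s_at :: "('a, 'h) pre_digraph \<Rightarrow> 'h embedding \<Rightarrow> 'a \<Rightarrow> 'h \<Rightarrow> 'h" where
  "s_at G E v = delete_outside (gamma E) (out_arcs G v)"

definition pi_at :: "('a, 'h) pre_digraph \<Rightarrow> 'h embedding \<Rightarrow> 'a \<Rightarrow> 'h \<Rightarrow> 'h" where
  "pi_at G E v = perm_restrict (beta E) (out_arcs G v)"

definition D_at :: "('a, 'h) pre_digraph \<Rightarrow> 'h embedding \<Rightarrow> 'a \<Rightarrow> 'h \<Rightarrow> 'h" where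
  "D_at G E v = s_at G E v \<circ> inv (pi_at G E v)"

end

theory Submission
  imports Defs
begin

text \<open>
  Re-embed \<open>G\<close> by changing the cyclic order of half edges at the single vertex \<open>v\<close>. Write
  \<open>H\<close> for the set of half edges at \<open>v\<close>, \<open>d\<close> for its size, \<open>\<pi>\<close> for the old
  rotation at \<open>v\<close> and \<open>p\<close> for the new one, a cyclic permutation of \<open>H\<close>. The face
  permutation \<open>\<gamma>\<close> turns into \<open>\<gamma> \<circ> \<tau>\<close> with \<open>\<tau> = inv \<pi> \<circ> p\<close>, which moves
  only elements of \<open>H\<close>. Hence faces avoiding \<open>v\<close> survive, while the faces at \<open>v\<close> are the
  cycles of the first return map to \<open>H\<close>, and this map turns from \<open>s = D \<circ> \<pi>\<close> into
  \<open>s \<circ> \<tau> = D \<circ> p\<close>. So \<open>D\<close> is an invariant of the rest of the embedding, and everything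
  reduces to the question which numbers of cycles \<open>D \<circ> p\<close> can have (\<open>rotation_replacement\<close>).

  The sign of a permutation is determined by the number of its cycles, so these numbers all have
  the parity of \<open>d + 1 - l\<close>, where \<open>l\<close> is the number of cycles of \<open>D\<close>. Conversely every
  \<open>k\<close> of this parity with \<open>1 \<le> k \<le> d + 1 - l\<close> occurs (\<open>attain_cycle_count\<close>). To
  reach the top, join the cycles of \<open>inv D\<close> with \<open>l - 1\<close> transpositions, whose product
  \<open>\<sigma>\<close> has at least \<open>d - (l - 1)\<close> cycles; then \<open>p = inv D \<circ> \<sigma>\<close> is a full cycle and
  \<open>D \<circ> p = \<sigma>\<close>. To go down by two from any count \<open>\<ge> 3\<close>, compose \<open>p\<close> with two
  transpositions on elements of three different cycles of \<open>D \<circ> p\<close>, chosen so that they first cut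
  and then rejoin \<open>p\<close>, while both join cycles of \<open>D \<circ> p\<close> (\<open>merge_three_cycles\<close>).

  By Euler's formula, \<open>k\<close> faces at \<open>v\<close> in place of \<open>q\<close> change the genus by
  \<open>(q - k) div 2\<close>, and the bounds on \<open>\<Delta>g\<close> are those on \<open>k\<close>. If \<open>v\<close> meets every
  face, going down to \<open>k \<in> {1, 2}\<close> leaves one or two faces altogether, which is the least
  number that parity permits; this is maximum genus.
\<close>

section \<open>Cycles of a permutation composed with a transposition\<close>

lemma orbit_eq_if_mem:
  "permutation f \<Longrightarrow> y \<in> orbit f x \<Longrightarrow> orbit f y = orbit f x"
  by (rule orbit_cyclic_eq3[OF cyclic_on_orbit'])

lemma orbits_disjoint_or_equal:
  assumes "permutation f" shows "orbit f x = orbit f y \<or> orbit f x \<inter> orbit f y = {}"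
  using orbit_eq_if_mem[OF assms] by blast

lemma permutation_transpose_right:
  "permutation f \<Longrightarrow> permutation (f \<circ> transpose a b)"
  by (simp add: permutation_compose permutation_swap_id)

text \<open>
  Swapping the images of \<open>a\<close> and \<open>b\<close> sends \<open>a\<close> to \<open>f b\<close>; from there the walk runs
  through the cycle of \<open>b\<close>, because \<open>f\<close> was altered only at \<open>b\<close>, where that cycle
  closes up, and at \<open>a\<close>, which is not on it.
\<close>

lemma orbit_subset_orbit_transpose:
  assumes f: "permutation f" and ab: "b \<notin> orbit f a"
  shows "orbit f b \<subseteq> orbit (f \<circ> transpose a b) a"
proof
  fix y assume "y \<in> orbit f b"
  then show "y \<in> orbit (f \<circ> transpose a b) a"
  proof induction
    case base
    show ?case by (metis orbit.base comp_apply transpose_apply_first)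
  next
    case (step y)
    have "y \<noteq> a" using step.hyps ab f
      by (metis orbit_swap permutation_self_in_orbit)
    show ?case
    proof (cases "y = b")
      case True
      then show ?thesis by (metis orbit.base comp_apply transpose_apply_first)
    next
      case False
      then show ?thesis using orbit.step[OF step.IH] \<open>y \<noteq> a\<close> by simp
    qed
  qed
qed

lemma orbit_transpose_merge:
  assumes f: "permutation f" and ab: "b \<notin> orbit f a"
  shows "orbit (f \<circ> transpose a b) a = orbit f a \<union> orbit f b"
    and "orbit (f \<circ> transpose a b) b = orbit f a \<union> orbit f b"
proof -
  let ?g = "f \<circ> transpose a b"
  have g: "permutation ?g" using f by (rule permutation_transpose_right)
  have self: "x \<in> orbit f x" for x using f by (rule permutation_self_in_orbit)
  have ba: "a \<notin> orbit f b" using ab self by (meson orbit_swap)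
  have 1: "orbit f b \<subseteq> orbit ?g a" using f ab by (rule orbit_subset_orbit_transpose)
  have 2: "orbit f a \<subseteq> orbit ?g b"
    using orbit_subset_orbit_transpose[OF f ba] by (simp add: transpose_commute)
  have eq: "orbit ?g b = orbit ?g a" using 1 self g orbit_eq_if_mem by fast
  have "y \<in> orbit f a \<union> orbit f b" if "y \<in> orbit ?g a" for y
    using that
  proof induction
    case base
    show ?case by (simp add: orbit.base)
  next
    case (step y)
    then show ?case by (cases "y = a"; cases "y = b") (auto intro: orbit.intros)
  qed
  then show "orbit ?g a = orbit f a \<union> orbit f b" using 1 2 eq by blast
  then show "orbit ?g b = orbit f a \<union> orbit f b" using eq by simp
qed

lemma finite_cycles_on: "finite S \<Longrightarrow> finite (cycles_on f S)"
  by (simp add: cycles_on_def)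

lemma card_cycles_on_merge:
  assumes f: "f permutes S" and S: "finite S" and "a \<in> S" "b \<in> S" and ab: "b \<notin> orbit f a"
  shows "card (cycles_on f S) = Suc (card (cycles_on (f \<circ> transpose a b) S))"
proof -
  let ?g = "f \<circ> transpose a b" and ?A = "orbit f a" and ?B = "orbit f b"
  have pf: "permutation f" using f S by (auto simp: permutation_permutes)
  have self: "x \<in> orbit f x" for x using pf by (rule permutation_self_in_orbit)
  define R where "R = {F \<in> cycles_on f S. F \<noteq> ?A \<and> F \<noteq> ?B}"
  have other: "orbit ?g x = orbit f x" if "x \<notin> ?A \<union> ?B" for x
  proof (rule orbit_cong[OF self])
    fix s assume "s \<in> orbit f x"
    then have "s \<noteq> a" "s \<noteq> b" using that self by (metis UnCI orbit_swap)+
    then show "?g s = f s" by simp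
  qed
  have mem: "x \<in> ?A \<union> ?B \<longleftrightarrow> orbit f x = ?A \<or> orbit f x = ?B" for x
    using self orbit_eq_if_mem[OF pf] by blast
  have AB: "?A \<noteq> ?B" using ab self by blast
  have "cycles_on f S = insert ?A (insert ?B R)"
    using assms(3,4) by (auto simp: R_def cycles_on_def)
  moreover have "cycles_on ?g S = insert (?A \<union> ?B) R"
  proof -
    have "orbit ?g x = (if x \<in> ?A \<union> ?B then ?A \<union> ?B else orbit f x)" for x
    proof (cases "x \<in> ?A \<union> ?B")
      case True
      then have "orbit ?g x = orbit ?g a"
        using orbit_transpose_merge[OF pf ab] orbit_eq_if_mem[OF permutation_transpose_right[OF pf]]
        by metis
      with True show ?thesis using orbit_transpose_merge[OF pf ab] by simp
    qed (use other in auto)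
    then have "cycles_on ?g S = (\<lambda>x. if x \<in> ?A \<union> ?B then ?A \<union> ?B else orbit f x) ` S"
      unfolding cycles_on_def by (intro image_cong refl)
    also have "\<dots> = insert (?A \<union> ?B) (orbit f ` {x \<in> S. x \<notin> ?A \<union> ?B})"
      using assms(3) self[of a] by auto
    also have "orbit f ` {x \<in> S. x \<notin> ?A \<union> ?B} = R"
      unfolding mem R_def cycles_on_def by auto
    finally show ?thesis .
  qed
  moreover have "finite R" using S by (simp add: R_def finite_cycles_on)
  moreover have "?A \<notin> R" "?B \<notin> R" by (simp_all add: R_def)
  moreover have "?A \<union> ?B \<notin> R"
  proof
    assume "?A \<union> ?B \<in> R"
    then obtain x where "?A \<union> ?B = orbit f x" by (auto simp: R_def cycles_on_def)
    then have "a \<in> orbit f x" using self by blast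
    then have "orbit f x = ?A" using orbit_eq_if_mem[OF pf] by metis
    with \<open>?A \<union> ?B = orbit f x\<close> \<open>?A \<union> ?B \<in> R\<close> show False by (simp add: R_def)
  qed
  ultimately show ?thesis using AB by simp
qed

text \<open>
  If \<open>a\<close> and \<open>b\<close> share a cycle, the stretch \<open>T\<close> of it from \<open>f a\<close> to the first
  \<open>b\<close> becomes closed, since \<open>b\<close> is now sent to \<open>f a\<close>; and \<open>T\<close> misses \<open>a\<close>.
\<close>

lemma orbit_transpose_split:
  assumes f: "permutation f" and ab: "b \<in> orbit f a" "a \<noteq> b"
  shows "b \<notin> orbit (f \<circ> transpose a b) a"
proof -
  let ?g = "f \<circ> transpose a b"
  define k where "k = funpow_dist1 f a b"
  define T where "T = {(f ^^ i) a | i. 0 < i \<and> i \<le> k}"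
  have k: "(f ^^ k) a = b" "0 < k" using funpow_dist1_prop[OF ab(1)] by (simp_all add: k_def)
  have nb: "(f ^^ i) a \<noteq> b" if "0 < i" "i < k" for i
    using funpow_dist1_least[of i f a b] that unfolding k_def by blast
  \<comment> \<open>An earlier return to \<open>a\<close> would bring the first visit to \<open>b\<close> forward.\<close>
  have na: "(f ^^ i) a \<noteq> a" if "0 < i" "i \<le> k" for i
  proof
    assume "(f ^^ i) a = a"
    moreover have "k = (k - i) + i" using that by simp
    ultimately have "(f ^^ (k - i)) a = b" using k(1) by (metis comp_apply funpow_add)
    then show False using nb[of "k - i"] that ab(2) by (cases "i = k") auto
  qed
  have "y \<in> T" if "y \<in> orbit ?g b" for y
    using that
  proof induction
    case base
    have "f a = (f ^^ 1) a" by simp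
    then show ?case using k(2) by (auto simp: T_def intro!: exI[of _ 1])
  next
    case (step y)
    then obtain i where i: "y = (f ^^ i) a" "0 < i" "i \<le> k" by (auto simp: T_def)
    show ?case
    proof (cases "i = k")
      case True
      then show ?thesis using i k by (auto simp: T_def intro!: exI[of _ 1])
    next
      case False
      then have "?g y = (f ^^ Suc i) a" using i na[of i] nb[of i] by simp
      then show ?thesis using i False unfolding T_def by (intro CollectI exI[of _ "Suc i"]) auto
    qed
  qed
  moreover have "a \<notin> T"
  proof
    assume "a \<in> T"
    then obtain i where "a = (f ^^ i) a" "0 < i" "i \<le> k" unfolding T_def by blast
    then show False using na[of i] by metis
  qed
  ultimately have "a \<notin> orbit ?g b" by blast
  then show ?thesis
    using permutation_transpose_right[OF f] by (metis orbit_swap permutation_self_in_orbit)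
qed

text \<open>
  A transposition is its own inverse, so splitting a cycle is joining read backwards.
\<close>

lemma card_cycles_on_split:
  assumes f: "f permutes S" and S: "finite S" and "a \<in> S" "b \<in> S" and ab: "b \<in> orbit f a" "a \<noteq> b"
  shows "card (cycles_on (f \<circ> transpose a b) S) = Suc (card (cycles_on f S))"
proof -
  have pf: "permutation f" using f S by (auto simp: permutation_permutes)
  have "f \<circ> transpose a b permutes S"
    using f assms(3,4) by (intro permutes_compose permutes_swap_id)
  from card_cycles_on_merge[OF this S assms(3,4) orbit_transpose_split[OF pf ab]]
  show ?thesis by (simp add: comp_assoc)
qed

lemma cycles_on_id:
  fixes S :: "'a set"
  shows "cycles_on id S = (\<lambda>x. {x}) ` S"
proof -
  have "orbit id x = {x}" for x :: 'a
    by (simp add: orbit_eq_singleton_iff)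
  then show ?thesis unfolding cycles_on_def by (rule image_cong[OF refl])
qed

text \<open>
  Each transposition changes both the sign and the parity of the number of cycles. Joining and
  splitting concern composition on the right, so the transposition on the left that the induction
  supplies is first moved across the permutation.
\<close>

lemma sign_eq_cycles:
  assumes "f permutes S" "finite S"
  shows "sign f = (-1) ^ (card S + card (cycles_on f S))"
  using assms
proof (induction rule: permutes_induct)
  case id
  have "card (cycles_on id S) = card S" unfolding cycles_on_id by (rule card_image) simp
  then show ?case by (simp only: sign_id) simp
next
  case (swap a b p)
  let ?a = "inv p a" and ?b = "inv p b"
  have pp: "permutation p" using swap assms(2) by (auto simp: permutation_permutes)
  have p: "p permutes S" by fact
  have eq: "transpose a b \<circ> p = p \<circ> transpose ?a ?b"
    using p by (auto simp: fun_eq_iff transpose_def permutes_inverses permutes_inv_eq)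
  have in_S: "?a \<in> S" "?b \<in> S" "?a \<noteq> ?b"
    using swap(1-3) permutes_in_image[OF permutes_inv[OF p]] permutes_inv_eq[OF p]
    by (auto simp: inj_eq[OF permutes_inj[OF permutes_inv[OF p]]])
  have sg: "sign (transpose a b \<circ> p) = - sign p"
    using swap(3) pp by (simp add: sign_compose permutation_swap_id sign_swap_id)
  show ?case
  proof (cases "?b \<in> orbit p ?a")
    case True
    have c: "card (cycles_on (transpose a b \<circ> p) S) = Suc (card (cycles_on p S))"
      unfolding eq by (rule card_cycles_on_split[OF p assms(2) in_S(1,2) True in_S(3)])
    show ?thesis unfolding sg swap.IH c by simp
  next
    case False
    have c: "card (cycles_on p S) = Suc (card (cycles_on (transpose a b \<circ> p) S))"
      unfolding eq by (rule card_cycles_on_merge[OF p assms(2) in_S(1,2) False])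
    show ?thesis unfolding sg swap.IH c by (simp only: add_Suc_right power_Suc mult_minus1 minus_minus)
  qed
qed

section \<open>Cycle counts of products with a full cycle\<close>

lemma permutes_transpose_right:
  "f permutes S \<Longrightarrow> a \<in> S \<Longrightarrow> b \<in> S \<Longrightarrow> f \<circ> transpose a b permutes S"
  by (intro permutes_compose permutes_swap_id)

lemma card_cycles_on_transpose_ge:
  assumes "f permutes S" "finite S" "a \<in> S" "b \<in> S"
  shows "card (cycles_on f S) \<le> Suc (card (cycles_on (f \<circ> transpose a b) S))"
proof (cases "b \<in> orbit f a \<and> a \<noteq> b")
  case True
  then show ?thesis using card_cycles_on_split[OF assms] by simp
next
  case False
  then consider "a = b" | "b \<notin> orbit f a" by blast
  then show ?thesis using card_cycles_on_merge[OF assms] by cases simp_all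
qed

text \<open>
  Join the cycles of \<open>f\<close> one after the other, using one transposition per join. A product of
  \<open>j\<close> transpositions arises from the identity, which has \<open>card S\<close> cycles, and each factor
  costs at most one of them.
\<close>

lemma cyclic_completion_with_many_cycles:
  assumes f: "f permutes S" and S: "finite S" "S \<noteq> {}"
  shows "\<exists>\<sigma>. \<sigma> permutes S \<and> card (cycles_on (f \<circ> \<sigma>) S) = 1 \<and>
           card S + 1 \<le> card (cycles_on \<sigma> S) + card (cycles_on f S)"
proof -
  let ?l = "card (cycles_on f S)"
  have l: "0 < ?l" using S by (simp add: card_gt_0_iff finite_cycles_on) (simp add: cycles_on_def)
  have "\<exists>\<sigma>. \<sigma> permutes S \<and> card (cycles_on (f \<circ> \<sigma>) S) + j = ?l \<and>
          card S \<le> card (cycles_on \<sigma> S) + j" if "j < ?l" for j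
    using that
  proof (induction j)
    case 0
    have "card (cycles_on id S) = card S" unfolding cycles_on_id by (rule card_image) simp
    then show ?case by (intro exI[of _ id]) (auto simp: permutes_id simp del: id_apply)
  next
    case (Suc j)
    then obtain \<sigma> where s: "\<sigma> permutes S" "card (cycles_on (f \<circ> \<sigma>) S) + j = ?l"
      "card S \<le> card (cycles_on \<sigma> S) + j"
      using Suc_lessD by blast
    have fs: "f \<circ> \<sigma> permutes S" using s(1) f by (rule permutes_compose)
    have "1 < card (cycles_on (f \<circ> \<sigma>) S)" using s(2) Suc.prems by linarith
    then obtain F F' where "F \<in> cycles_on (f \<circ> \<sigma>) S" "F' \<in> cycles_on (f \<circ> \<sigma>) S" "F \<noteq> F'"
      by (metis S(1) finite_cycles_on card_le_Suc0_iff_eq not_less One_nat_def)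
    then obtain a b where ab: "a \<in> S" "b \<in> S" "orbit (f \<circ> \<sigma>) a \<noteq> orbit (f \<circ> \<sigma>) b"
      by (auto simp: cycles_on_def)
    have "permutation (f \<circ> \<sigma>)" using fs S(1) by (auto simp: permutation_permutes)
    then have "b \<notin> orbit (f \<circ> \<sigma>) a" using ab(3) orbit_eq_if_mem by metis
    from card_cycles_on_merge[OF fs S(1) ab(1,2) this]
    have "card (cycles_on (f \<circ> (\<sigma> \<circ> transpose a b)) S) + Suc j = ?l"
      using s(2) by (simp add: comp_assoc)
    moreover have "card S \<le> card (cycles_on (\<sigma> \<circ> transpose a b) S) + Suc j"
      using card_cycles_on_transpose_ge[OF s(1) S(1) ab(1,2)] s(3) by linarith
    ultimately show ?case using permutes_transpose_right[OF s(1) ab(1,2)] by blast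
  qed
  from this[of "?l - 1"] l obtain \<sigma> where "\<sigma> permutes S" "card (cycles_on (f \<circ> \<sigma>) S) + (?l - 1) = ?l"
    "card S \<le> card (cycles_on \<sigma> S) + (?l - 1)" by auto
  then show ?thesis using l by (intro exI[of _ \<sigma>]) linarith
qed

lemma single_cycle_orbit:
  assumes p: "p permutes S" "finite S" "card (cycles_on p S) = 1" and x: "x \<in> S"
  shows "orbit p x = S"
proof
  show "orbit p x \<subseteq> S" using p(1) x by (rule permutes_orbit_subset)
  show "S \<subseteq> orbit p x"
  proof
    fix y assume "y \<in> S"
    then have "orbit p x = orbit p y"
      using p(2,3) x by (auto simp: cycles_on_def card_1_singleton_iff dest!: equalityD1)
    moreover have "permutation p" using p by (auto simp: permutation_permutes)
    ultimately show "y \<in> orbit p x" using permutation_self_in_orbit by metis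
  qed
qed

text \<open>
  Let \<open>a\<close>, \<open>b\<close>, \<open>c\<close> lie on different cycles of \<open>D \<circ> p\<close>. Composing with the
  transposition of \<open>a\<close> and \<open>b\<close> cuts the full cycle \<open>p\<close> in two, one part through \<open>a\<close>
  and one through \<open>b\<close>. Let \<open>x\<close> be the one of \<open>a\<close>, \<open>b\<close> whose part does not contain
  \<open>c\<close>; transposing \<open>x\<close> and \<open>c\<close> then rejoins the two parts. In \<open>D \<circ> p\<close> the first
  transposition joins the cycles of \<open>a\<close> and \<open>b\<close>, so whichever \<open>x\<close> was taken, the second
  one joins the result to the cycle of \<open>c\<close>.
\<close>

lemma merge_three_cycles:
  assumes D: "D permutes S" and S: "finite S"
    and p: "p permutes S" "card (cycles_on p S) = 1"
    and k: "3 \<le> card (cycles_on (D \<circ> p) S)"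
  shows "\<exists>p'. p' permutes S \<and> card (cycles_on p' S) = 1 \<and>
           card (cycles_on (D \<circ> p') S) + 2 = card (cycles_on (D \<circ> p) S)"
proof -
  let ?s = "D \<circ> p"
  obtain T where "T \<subseteq> cycles_on ?s S" "card T = 3" using k by (meson obtain_subset_with_card_n)
  then obtain F1 F2 F3 where "F1 \<in> cycles_on ?s S" "F2 \<in> cycles_on ?s S" "F3 \<in> cycles_on ?s S"
    "F1 \<noteq> F2" "F1 \<noteq> F3" "F2 \<noteq> F3" by (auto simp: card_3_iff)
  then obtain a b c where abc: "a \<in> S" "b \<in> S" "c \<in> S"
    and ne: "orbit ?s a \<noteq> orbit ?s b" "orbit ?s a \<noteq> orbit ?s c" "orbit ?s b \<noteq> orbit ?s c"
    by (auto simp: cycles_on_def)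
  have s: "?s permutes S" using p(1) D by (rule permutes_compose)
  have pms: "permutation ?s" using s S by (auto simp: permutation_permutes)
  have b: "b \<notin> orbit ?s a" and c: "c \<notin> orbit ?s a \<union> orbit ?s b"
    using ne orbit_eq_if_mem[OF pms] by blast+
  have pmp: "permutation p" using p S by (auto simp: permutation_permutes)
  have "a \<noteq> b" using ne by auto
  have bp: "b \<in> orbit p a" using single_cycle_orbit[OF p(1) S p(2) abc(1)] abc(2) by simp
  let ?g = "p \<circ> transpose a b" and ?s1 = "?s \<circ> transpose a b"
  have g: "?g permutes S" and s1: "?s1 permutes S"
    using p(1) s abc by (simp_all add: permutes_transpose_right del: comp_apply)
  have bg: "b \<notin> orbit ?g a" using pmp bp \<open>a \<noteq> b\<close> by (rule orbit_transpose_split)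
  define x where "x = (if c \<in> orbit ?g a then b else a)"
  have x: "x \<in> S" using abc by (simp add: x_def)
  have "permutation ?g" using pmp by (rule permutation_transpose_right)
  then have "c \<notin> orbit ?g x"
    using bg unfolding x_def by (metis orbit_eq_if_mem permutation_self_in_orbit)
  then have "card (cycles_on ?g S) = Suc (card (cycles_on (?g \<circ> transpose x c) S))"
    by (rule card_cycles_on_merge[OF g S x abc(3)])
  then have 1: "card (cycles_on (p \<circ> (transpose a b \<circ> transpose x c)) S) = 1"
    using card_cycles_on_split[OF p(1) S abc(1,2) bp \<open>a \<noteq> b\<close>] p(2) by (simp add: comp_assoc)
  have "c \<notin> orbit ?s1 x"
    using c orbit_transpose_merge[OF pms b] by (simp add: x_def)
  then have "card (cycles_on ?s1 S) = Suc (card (cycles_on (?s1 \<circ> transpose x c) S))"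
    by (rule card_cycles_on_merge[OF s1 S x abc(3)])
  then have 2: "card (cycles_on (D \<circ> (p \<circ> (transpose a b \<circ> transpose x c))) S) + 2
      = card (cycles_on ?s S)"
    using card_cycles_on_merge[OF s S abc(1,2) b] by (simp add: comp_assoc)
  have "p \<circ> (transpose a b \<circ> transpose x c) permutes S"
    using permutes_transpose_right[OF g x abc(3)] by (simp add: comp_assoc)
  with 1 2 show ?thesis by blast
qed

lemma lower_cycle_count:
  assumes D: "D permutes S" and S: "finite S"
    and "p permutes S" "card (cycles_on p S) = 1"
    and "1 \<le> k" "k \<le> card (cycles_on (D \<circ> p) S)" "even (card (cycles_on (D \<circ> p) S) + k)"
  shows "\<exists>p'. p' permutes S \<and> card (cycles_on p' S) = 1 \<and> card (cycles_on (D \<circ> p') S) = k"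
  using assms(3-)
proof (induction "card (cycles_on (D \<circ> p) S)" arbitrary: p rule: less_induct)
  case less
  let ?n = "card (cycles_on (D \<circ> p) S)"
  show ?case
  proof (cases "?n = k")
    case True
    then show ?thesis using less.prems by blast
  next
    case False
    have "k + 2 \<le> n" if "n \<noteq> k" "k \<le> n" "even (n + k)" for n
      using that by presburger
    from this[OF False less.prems(4,5)] have "k + 2 \<le> ?n" .
    then obtain p' where p': "p' permutes S" "card (cycles_on p' S) = 1"
      "card (cycles_on (D \<circ> p') S) + 2 = ?n"
      using merge_three_cycles[OF D S less.prems(1,2)] less.prems(3) by auto
    show ?thesis
    proof (rule less.hyps[OF _ p'(1,2) less.prems(3)])
      show "card (cycles_on (D \<circ> p') S) < ?n" "k \<le> card (cycles_on (D \<circ> p') S)"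
        using p'(3) \<open>k + 2 \<le> ?n\<close> by linarith+
      show "even (card (cycles_on (D \<circ> p') S) + k)" using less.prems(5) unfolding p'(3)[symmetric] by simp
    qed
  qed
qed

lemma parity_cycles_comp:
  assumes "f permutes S" "g permutes S" "finite S"
  shows "even (card (cycles_on (f \<circ> g) S) + card (cycles_on f S) + card (cycles_on g S) + card S)"
proof -
  have "permutation f" "permutation g" using assms by (auto simp: permutation_permutes)
  then have "sign (f \<circ> g) = sign f * sign g" by (rule sign_compose)
  then have "(-1 :: int) ^ (card S + card (cycles_on (f \<circ> g) S)) =
      (-1) ^ (card S + card (cycles_on f S)) * (-1) ^ (card S + card (cycles_on g S))"
    using assms permutes_compose[OF assms(2,1)] by (simp only: sign_eq_cycles)
  then have "even (card S + card (cycles_on (f \<circ> g) S)) =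
      even (card S + card (cycles_on f S) + (card S + card (cycles_on g S)))"
    by (metis power_add minus_one_power_iff one_neq_neg_one)
  then show ?thesis by presburger
qed

text \<open>
  With \<open>\<sigma>\<close> completing \<open>inv D\<close> to a full cycle \<open>p\<close>, the product \<open>D \<circ> p\<close> is
  \<open>\<sigma>\<close> itself, which has at least as many cycles as \<open>k\<close> is allowed to be; steps of two
  lead down to \<open>k\<close>.
\<close>

lemma attain_cycle_count:
  assumes D: "D permutes S" and S: "finite S" "S \<noteq> {}"
    and k: "1 \<le> k" "k + card (cycles_on D S) \<le> card S + 1" "even (k + card (cycles_on D S) + card S + 1)"
  shows "\<exists>p. p permutes S \<and> card (cycles_on p S) = 1 \<and> card (cycles_on (D \<circ> p) S) = k"
proof -
  have Di: "inv D permutes S" using D by (rule permutes_inv)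
  have "permutation D" using D S by (auto simp: permutation_permutes)
  then have eq: "cycles_on (inv D) S = cycles_on D S" by (simp add: cycles_on_def orbit_inv_eq)
  obtain \<sigma> where s: "\<sigma> permutes S" "card (cycles_on (inv D \<circ> \<sigma>) S) = 1"
    "card S + 1 \<le> card (cycles_on \<sigma> S) + card (cycles_on D S)"
    using cyclic_completion_with_many_cycles[OF Di S] eq by auto
  have p: "inv D \<circ> \<sigma> permutes S" using s(1) Di by (rule permutes_compose)
  have Dp: "D \<circ> (inv D \<circ> \<sigma>) = \<sigma>" by (simp add: comp_assoc[symmetric] permutes_inv_o[OF D])
  show ?thesis
  proof (rule lower_cycle_count[OF D S(1) p s(2) k(1)])
    show "k \<le> card (cycles_on (D \<circ> (inv D \<circ> \<sigma>)) S)" using Dp s(3) k(2) by simp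
    show "even (card (cycles_on (D \<circ> (inv D \<circ> \<sigma>)) S) + k)"
      using parity_cycles_comp[OF D p S(1)] k(3) unfolding s(2) Dp
      by (metis (no_types, opaque_lifting) even_add)
  qed
qed

section \<open>First return maps\<close>

lemma delete_outside_cases:
  assumes f: "permutation f" and x: "x \<in> H"
  obtains n where "0 < n" "delete_outside f H x = (f ^^ n) x" "(f ^^ n) x \<in> H"
    "\<And>m. 0 < m \<Longrightarrow> m < n \<Longrightarrow> (f ^^ m) x \<notin> H"
proof -
  let ?P = "\<lambda>n. 0 < n \<and> (f ^^ n) x \<in> H"
  obtain n0 where "?P n0" using permutation_self[OF f, of x] x by metis
  then have "?P (LEAST n. ?P n)" by (rule LeastI)
  moreover have "(f ^^ m) x \<notin> H" if "0 < m" "m < (LEAST n. ?P n)" for m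
    using not_less_Least[OF that(2)] that(1) by blast
  ultimately show ?thesis using that[of "LEAST n. ?P n"] x by (auto simp: delete_outside_def)
qed

lemma delete_outside_eqI:
  assumes "x \<in> H" "0 < n" "(f ^^ n) x \<in> H" "\<And>m. 0 < m \<Longrightarrow> m < n \<Longrightarrow> (f ^^ m) x \<notin> H"
  shows "delete_outside f H x = (f ^^ n) x"
proof -
  have "(LEAST n. 0 < n \<and> (f ^^ n) x \<in> H) = n"
    using assms by (intro Least_equality) (auto simp: not_less[symmetric])
  then show ?thesis using assms(1) by (simp add: delete_outside_def)
qed

text \<open>
  If two points of \<open>H\<close> return to the same place, after \<open>n\<close> and \<open>m \<ge> n\<close> steps, then the one that
  takes \<open>m\<close> steps passes through the other after \<open>m - n\<close> steps; as this other lies in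
  \<open>H\<close> and \<open>m\<close> is the time of first return, \<open>m = n\<close>.
\<close>

lemma delete_outside_permutes:
  assumes f: "permutation f" and H: "finite H"
  shows "delete_outside f H permutes H"
proof -
  let ?r = "delete_outside f H"
  have into: "?r x \<in> H" if "x \<in> H" for x
    using delete_outside_cases[OF f that, of "?r x \<in> H"] by metis
  have wlog: "x = y"
    if "x \<in> H" "y \<in> H" "n \<le> m" "0 < n" "(f ^^ n) x = (f ^^ m) y"
      and "\<And>i. 0 < i \<Longrightarrow> i < m \<Longrightarrow> (f ^^ i) y \<notin> H" for x y n m
  proof -
    have "(f ^^ n) x = (f ^^ n) ((f ^^ (m - n)) y)"
      using that(3,5) by (metis comp_apply funpow_add le_add_diff_inverse)
    moreover have "inj (f ^^ n)" using f by (intro inj_fn) (simp add: permutation_bijective bij_is_inj)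
    ultimately have x: "x = (f ^^ (m - n)) y" by (simp add: inj_eq)
    with that have "\<not> (0 < m - n \<and> m - n < m)" by metis
    with that(3,4) have "m - n = 0" by linarith
    with x show ?thesis by simp
  qed
  have "inj_on ?r H"
  proof (rule inj_onI)
    fix x y assume xy: "x \<in> H" "y \<in> H" "?r x = ?r y"
    obtain n where n: "0 < n" "?r x = (f ^^ n) x" "\<And>m. 0 < m \<Longrightarrow> m < n \<Longrightarrow> (f ^^ m) x \<notin> H"
      using delete_outside_cases[OF f xy(1)] by metis
    obtain m where m: "0 < m" "?r y = (f ^^ m) y" "\<And>i. 0 < i \<Longrightarrow> i < m \<Longrightarrow> (f ^^ i) y \<notin> H"
      using delete_outside_cases[OF f xy(2)] by metis
    show "x = y"
      using wlog[of x y n m] wlog[of y x m n] n m xy by (metis nat_le_linear)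
  qed
  with into have "bij_betw ?r H H"
    using H by (metis bij_betw_def endo_inj_surj image_subsetI)
  then show ?thesis by (rule bij_imp_permutes) (simp add: delete_outside_def)
qed

lemma orbit_delete_outside:
  assumes f: "permutation f" and H: "finite H" and x: "x \<in> H"
  shows "orbit (delete_outside f H) x = orbit f x \<inter> H"
proof
  let ?r = "delete_outside f H"
  have step: "?r y \<in> orbit f y \<and> ?r y \<in> H" if "y \<in> H" for y
    using delete_outside_cases[OF f that] by (metis (mono_tags, lifting) mem_Collect_eq orbit_altdef)
  show "orbit ?r x \<subseteq> orbit f x \<inter> H"
  proof
    fix y assume "y \<in> orbit ?r x"
    then show "y \<in> orbit f x \<inter> H"
      by induction (use step x in \<open>auto intro: orbit_trans\<close>)
  qed
  have "(f ^^ n) y \<in> orbit ?r y" if "y \<in> H" "0 < n" "(f ^^ n) y \<in> H" for n y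
    using that
  proof (induction n arbitrary: y rule: less_induct)
    case (less n)
    obtain m where m: "0 < m" "?r y = (f ^^ m) y" "(f ^^ m) y \<in> H"
      "\<And>i. 0 < i \<Longrightarrow> i < m \<Longrightarrow> (f ^^ i) y \<notin> H"
      using delete_outside_cases[OF f less.prems(1)] by metis
    then have "m \<le> n" using less.prems by (meson not_le)
    show ?case
    proof (cases "m = n")
      case True
      then show ?thesis using m(2) by (metis orbit.base)
    next
      case False
      have eq: "(f ^^ (n - m)) (?r y) = (f ^^ n) y"
        using \<open>m \<le> n\<close> m(2) by (metis comp_apply funpow_add le_add_diff_inverse2)
      then have "(f ^^ n) y \<in> orbit ?r (?r y)"
        using less.IH[of "n - m" "?r y"] m False \<open>m \<le> n\<close> less.prems by auto
      then show ?thesis by (rule orbit_subset)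
    qed
  qed
  then show "orbit f x \<inter> H \<subseteq> orbit ?r x" using x by (auto simp: orbit_altdef[of f])
qed

lemma card_cycles_on_delete_outside:
  assumes f: "f permutes A" and A: "finite A" and HA: "H \<subseteq> A"
  shows "card (cycles_on (delete_outside f H) H) = card {F \<in> cycles_on f A. F \<inter> H \<noteq> {}}"
proof -
  let ?C = "{F \<in> cycles_on f A. F \<inter> H \<noteq> {}}"
  have H: "finite H" using A HA by (rule finite_subset[rotated])
  have pf: "permutation f" using f A by (auto simp: permutation_permutes)
  have self: "x \<in> orbit f x" for x using pf by (rule permutation_self_in_orbit)
  have C: "?C = orbit f ` H"
    using HA self orbit_eq_if_mem[OF pf] unfolding cycles_on_def by blast
  have "cycles_on (delete_outside f H) H = (\<lambda>F. F \<inter> H) ` ?C"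
    unfolding C image_image unfolding cycles_on_def
    by (rule image_cong) (simp_all add: orbit_delete_outside[OF pf H])
  moreover have "inj_on (\<lambda>F. F \<inter> H) ?C"
  proof (rule inj_onI)
    fix F F' assume "F \<in> ?C" "F' \<in> ?C" and eq: "F \<inter> H = F' \<inter> H"
    then obtain x y where xy: "x \<in> H" "F = orbit f x" "F' = orbit f y" unfolding C by blast
    then have "x \<in> orbit f y" using eq self[of x] by blast
    then show "F = F'" using orbit_eq_if_mem[OF pf] xy(2,3) by metis
  qed
  ultimately show ?thesis by (simp add: card_image)
qed

text \<open>
  Following \<open>f \<circ> \<tau>\<close> from a point of \<open>H\<close>, the permutation \<open>\<tau>\<close> acts only in the first
  step, because all later points before the return lie outside \<open>H\<close>.
\<close>

lemma delete_outside_comp: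
  assumes f: "permutation f" and t: "\<tau> permutes H"
  shows "delete_outside (f \<circ> \<tau>) H = delete_outside f H \<circ> \<tau>"
proof
  fix x show "delete_outside (f \<circ> \<tau>) H x = (delete_outside f H \<circ> \<tau>) x"
  proof (cases "x \<in> H")
    case True
    then have tx: "\<tau> x \<in> H" using t by (simp add: permutes_in_image)
    obtain n where n: "0 < n" "delete_outside f H (\<tau> x) = (f ^^ n) (\<tau> x)" "(f ^^ n) (\<tau> x) \<in> H"
      "\<And>m. 0 < m \<Longrightarrow> m < n \<Longrightarrow> (f ^^ m) (\<tau> x) \<notin> H"
      using delete_outside_cases[OF f tx] by metis
    have eq: "((f \<circ> \<tau>) ^^ m) x = (f ^^ m) (\<tau> x)" if "0 < m" "m \<le> n" for m
      using that
    proof (induction m)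
      case (Suc m)
      show ?case
      proof (cases "m = 0")
        case False
        then have "\<tau> ((f ^^ m) (\<tau> x)) = (f ^^ m) (\<tau> x)"
          using n(4)[of m] Suc.prems t by (simp add: permutes_not_in)
        then show ?thesis using Suc False by simp
      qed simp
    qed simp
    show ?thesis
      using delete_outside_eqI[of x H n "f \<circ> \<tau>"] True n eq by simp
  next
    case False
    then show ?thesis using permutes_not_in[OF t] by (simp add: delete_outside_def)
  qed
qed

text \<open>
  Cycles that avoid \<open>H\<close> are not affected by \<open>\<tau>\<close>, and those that meet \<open>H\<close> are counted
  by the cycles of the first return map. Since this is an equation between naturals, the two
  differences are stated as equal by adding crosswise.
\<close>

lemma card_cycles_on_local_change:
  assumes f: "f permutes A" and A: "finite A" and HA: "H \<subseteq> A" and t: "\<tau> permutes H"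
  shows "card (cycles_on (f \<circ> \<tau>) A) + card (cycles_on (delete_outside f H) H) =
         card (cycles_on f A) + card (cycles_on (delete_outside f H \<circ> \<tau>) H)"
proof -
  let ?off = "\<lambda>f. {F \<in> cycles_on f A. F \<inter> H = {}}"
  have H: "finite H" using A HA by (rule finite_subset[rotated])
  have pf: "permutation f" using f A by (auto simp: permutation_permutes)
  have ft: "f \<circ> \<tau> permutes A" using f t HA by (meson permutes_compose permutes_subset)
  have split: "card (cycles_on h A) = card (?off h) + card (cycles_on (delete_outside h H) H)"
    if h: "h permutes A" for h
  proof -
    have "cycles_on h A = ?off h \<union> {F \<in> cycles_on h A. F \<inter> H \<noteq> {}}" by blast
    moreover have "finite (cycles_on h A)" using A by (rule finite_cycles_on)
    ultimately have "card (cycles_on h A) = card (?off h) + card {F \<in> cycles_on h A. F \<inter> H \<noteq> {}}"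
      using card_Un_disjoint[of "?off h" "{F \<in> cycles_on h A. F \<inter> H \<noteq> {}}"] by auto
    then show ?thesis using card_cycles_on_delete_outside[OF h A HA] by simp
  qed
  have sub: "?off h \<subseteq> ?off g" if h: "h permutes A" and eq: "\<And>y. y \<notin> H \<Longrightarrow> g y = h y" for g h
  proof
    fix F assume "F \<in> ?off h"
    then obtain x where x: "x \<in> A" "F = orbit h x" "F \<inter> H = {}" by (auto simp: cycles_on_def)
    have "permutation h" using h A by (auto simp: permutation_permutes)
    then have "x \<in> orbit h x" by (rule permutation_self_in_orbit)
    then have "orbit g x = orbit h x"
    proof (rule orbit_cong)
      show "g s = h s" if "s \<in> orbit h x" for s using eq[of s] that x(2,3) by blast
    qed
    with x show "F \<in> ?off g" unfolding cycles_on_def by blast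
  qed
  have eq: "(f \<circ> \<tau>) y = f y" if "y \<notin> H" for y using permutes_not_in[OF t that] by simp
  have "?off (f \<circ> \<tau>) = ?off f"
    using sub[OF ft eq[symmetric]] sub[OF f eq] by (rule equalityI)
  then have "card (?off (f \<circ> \<tau>)) = card (?off f)" by (rule arg_cong)
  with split[OF f] split[OF ft, unfolded delete_outside_comp[OF pf t]] show ?thesis by linarith
qed

section \<open>Replacing the rotation at one vertex\<close>

context multigraph
begin

lemma embedding_permutes:
  assumes "is_embedding G arev E"
  shows "beta E permutes arcs G" "gamma E permutes arcs G" "gamma E = arev \<circ> beta E"
  using assms arev_permutes_arcs by (auto simp: is_embedding_def intro: permutes_compose)

text \<open>
  Regarding edges as cycles of \<open>arev\<close>, like vertices as cycles of \<open>beta\<close>, makes the parity of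
  the Euler characteristic a statement about signs.
\<close>

lemma edges_of_eq_cycles: "edges_of G arev = cycles_on arev (arcs G)"
proof -
  have "orbit arev a = {a, arev a}" for a
  proof
    show "orbit arev a \<subseteq> {a, arev a}"
    proof
      fix y assume "y \<in> orbit arev a"
      then show "y \<in> {a, arev a}" by induction auto
    qed
    show "{a, arev a} \<subseteq> orbit arev a"
      using orbit.base[of arev a] orbit.step[OF orbit.base, of arev a] by simp
  qed
  then show ?thesis by (simp add: edges_of_def cycles_on_def)
qed

lemma even_card_arcs: "even (card (arcs G))"
proof -
  have "2 * card (edges_of G arev) = card (\<Union>(edges_of G arev))"
  proof (rule card_partition)
    show "finite (edges_of G arev)" by (simp add: edges_of_def)
    show "finite (\<Union>(edges_of G arev))" by (auto simp: edges_of_def)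
    show "card c = 2" if c: "c \<in> edges_of G arev" for c
    proof -
      obtain a where "a \<in> arcs G" "c = {a, arev a}" using c unfolding edges_of_def by blast
      then show ?thesis using arev_neq[of a] by simp
    qed
    show "c1 \<inter> c2 = {}" if c: "c1 \<in> edges_of G arev" "c2 \<in> edges_of G arev" and ne: "c1 \<noteq> c2" for c1 c2
    proof -
      have "permutation arev"
        using arev_permutes_arcs by (auto simp: permutation_permutes intro: finite_arcs)
      moreover obtain a b where "c1 = orbit arev a" "c2 = orbit arev b"
        using c unfolding edges_of_eq_cycles cycles_on_def by blast
      ultimately show ?thesis using ne orbits_disjoint_or_equal by metis
    qed
  qed
  moreover have "\<Union>(edges_of G arev) = arcs G" by (auto simp: edges_of_def)
  ultimately show ?thesis by (metis dvd_triv_left)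
qed

lemma embedding_vertex_cycle:
  assumes E: "is_embedding G arev E"
  shows "v \<in> verts G \<Longrightarrow> out_arcs G v \<noteq> {}"
    and "x \<in> out_arcs G v \<Longrightarrow> orbit (beta E) x = out_arcs G v"
proof -
  have c: "cycles_on (beta E) (arcs G) = out_arcs G ` verts G"
    using E by (simp add: is_embedding_def)
  show "out_arcs G v \<noteq> {}" if "v \<in> verts G"
    using that c orbit_nonempty unfolding cycles_on_def by (metis (no_types, lifting) image_iff)
  show "orbit (beta E) x = out_arcs G v" if x: "x \<in> out_arcs G v"
  proof -
    have "orbit (beta E) x \<in> out_arcs G ` verts G" using x c by (auto simp: cycles_on_def)
    then obtain w where w: "orbit (beta E) x = out_arcs G w" by blast
    have "permutation (beta E)"
      using embedding_permutes(1)[OF E] by (auto simp: permutation_permutes intro: finite_arcs)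
    then have "x \<in> out_arcs G w" using w permutation_self_in_orbit by metis
    with x w show ?thesis by simp
  qed
qed

lemma card_verts_eq_cycles:
  assumes "is_embedding G arev E"
  shows "card (verts G) = card (cycles_on (beta E) (arcs G))"
proof -
  have "inj_on (out_arcs G) (verts G)"
  proof (rule inj_onI)
    fix v w assume "v \<in> verts G" "w \<in> verts G" "out_arcs G v = out_arcs G w"
    moreover obtain x where "x \<in> out_arcs G v"
      using embedding_vertex_cycle(1)[OF assms \<open>v \<in> verts G\<close>] by blast
    ultimately have "x \<in> out_arcs G v" "x \<in> out_arcs G w" by simp_all
    then show "v = w" by simp
  qed
  then show ?thesis using assms by (simp add: is_embedding_def card_image)
qed

text \<open>
  The genus is defined by a description that is only meaningful if the Euler characteristic is even.
  This follows by comparing signs in \<open>gamma = alpha \<circ> beta\<close>, the number of half edges being even.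
\<close>

lemma two_genus:
  assumes E: "is_embedding G arev E"
  shows "2 * genus G arev E
    = 2 - int (card (verts G)) + int (card (edges_of G arev)) - int (card (faces G E))"
proof -
  have "even (card (faces G E) + card (edges_of G arev) + card (verts G) + card (arcs G))"
    using parity_cycles_comp[OF arev_permutes_arcs embedding_permutes(1)[OF E] finite_arcs]
    by (simp add: faces_def embedding_permutes(3)[OF E] edges_of_eq_cycles card_verts_eq_cycles[OF E])
  moreover have "even (2 - int V + int e - int F)" if "even (F + e + V + n)" "even n" for V e F n :: nat
    using that by presburger
  ultimately have "even (2 - int (card (verts G)) + int (card (edges_of G arev)) - int (card (faces G E)))"
    using even_card_arcs by metis
  then obtain h where
    h: "2 - int (card (verts G)) + int (card (edges_of G arev)) - int (card (faces G E)) = 2 * h"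
    by (elim evenE)
  have "genus G arev E = h" unfolding genus_def by (rule the_equality) (use h in linarith)+
  with h show ?thesis by simp
qed

text \<open>
  The rotation \<open>\<pi>\<close> at \<open>v\<close> is a full cycle because \<open>H\<close> is one cycle of \<open>beta E\<close>,
  and each face at \<open>v\<close> contributes one cycle to the first return map \<open>s = D \<circ> \<pi>\<close>.
\<close>

lemma local_permutations:
  assumes E: "is_embedding G arev E" and v: "v \<in> verts G"
  shows "pi_at G E v permutes out_arcs G v" "D_at G E v permutes out_arcs G v"
    "card (cycles_on (pi_at G E v) (out_arcs G v)) = 1"
    "s_at G E v = D_at G E v \<circ> pi_at G E v"
    "card (incident_faces G E v) = card (cycles_on (s_at G E v) (out_arcs G v))"
proof -
  let ?H = "out_arcs G v"
  have HA: "?H \<subseteq> arcs G" by auto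
  have pg: "permutation (gamma E)"
    using embedding_permutes(2)[OF E] by (auto simp: permutation_permutes intro: finite_arcs)
  obtain x where x: "x \<in> ?H" using embedding_vertex_cycle(1)[OF E v] by blast
  have into: "beta E y \<in> ?H" if "y \<in> ?H" for y
    using embedding_vertex_cycle(2)[OF E that] orbit.base[of "beta E" y] by simp
  have inj: "inj_on (beta E) ?H"
    using embedding_permutes(1)[OF E] by (rule permutes_inj_on)
  have "bij_betw (beta E) ?H ?H"
    using inj into by (metis bij_betw_def endo_inj_surj finite_out_arcs image_subsetI)
  then have "bij_betw (pi_at G E v) ?H ?H"
    by (rule bij_betw_cong[THEN iffD1, rotated]) (simp add: pi_at_def perm_restrict_simps)
  then show pi: "pi_at G E v permutes ?H"
    by (rule bij_imp_permutes) (unfold pi_at_def, rule perm_restrict_simps(2))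
  have s: "s_at G E v permutes ?H"
    unfolding s_at_def using pg finite_out_arcs by (rule delete_outside_permutes)
  show "D_at G E v permutes ?H"
    unfolding D_at_def using permutes_inv[OF pi] s by (rule permutes_compose)
  show "s_at G E v = D_at G E v \<circ> pi_at G E v"
    by (simp add: D_at_def comp_assoc permutes_inv_o[OF pi])
  have "orbit (pi_at G E v) y = ?H" if "y \<in> ?H" for y
  proof -
    have "orbit (beta E) y = orbit (pi_at G E v) y"
      using that into by (intro orbit_cong0[of y ?H]) (auto simp: pi_at_def perm_restrict_def)
    then show ?thesis using embedding_vertex_cycle(2)[OF E that] by simp
  qed
  then have "cycles_on (pi_at G E v) ?H = {?H}" using x unfolding cycles_on_def by blast
  then show "card (cycles_on (pi_at G E v) ?H) = 1" by simp
  show "card (incident_faces G E v) = card (cycles_on (s_at G E v) ?H)"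
    unfolding incident_faces_def faces_def face_incident_def s_at_def
    by (rule card_cycles_on_delete_outside[OF embedding_permutes(2)[OF E] finite_arcs HA, symmetric])
qed

text \<open>
  The new vertex permutation is \<open>beta E \<circ> \<tau>\<close> with \<open>\<tau> = inv \<pi> \<circ> p\<close>: it agrees with
  \<open>p\<close> at \<open>v\<close> and with \<open>beta E\<close> elsewhere, so its cycles are still the vertices of
  \<open>G\<close>.
\<close>

lemma rotation_replacement:
  assumes E: "is_embedding G arev E" and v: "v \<in> verts G"
    and p: "p permutes out_arcs G v" "card (cycles_on p (out_arcs G v)) = 1"
  shows "\<exists>E'. is_embedding G arev E' \<and>
    card (faces G E') + card (incident_faces G E v) =
    card (faces G E) + card (cycles_on (D_at G E v \<circ> p) (out_arcs G v))"
proof -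
  let ?H = "out_arcs G v"
  note loc = local_permutations[OF E v]
  define \<tau> where "\<tau> = inv (pi_at G E v) \<circ> p"
  define b where "b = beta E \<circ> \<tau>"
  define E' where "E' = \<lparr>alpha = arev, beta = b, gamma = arev \<circ> b\<rparr>"
  have HA: "?H \<subseteq> arcs G" by auto
  have tau: "\<tau> permutes ?H"
    unfolding \<tau>_def using p(1) permutes_inv[OF loc(1)] by (rule permutes_compose)
  have b: "b permutes arcs G"
    unfolding b_def using embedding_permutes(1)[OF E] tau HA
    by (meson permutes_compose permutes_subset)
  have pb: "permutation (beta E)"
    using embedding_permutes(1)[OF E] by (auto simp: permutation_permutes intro: finite_arcs)
  have b_in: "b x = p x" if "x \<in> ?H" for x
  proof -
    have "\<tau> x \<in> ?H" using permutes_in_image[OF tau] that by blast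
    then have "b x = pi_at G E v (\<tau> x)" by (simp add: b_def pi_at_def perm_restrict_simps)
    then show ?thesis by (simp add: \<tau>_def permutes_inverses[OF loc(1)])
  qed
  have b_out: "b x = beta E x" if "x \<notin> ?H" for x
    using permutes_not_in[OF tau that] by (simp add: b_def)
  have "orbit b x = orbit (beta E) x" if x: "x \<in> arcs G" for x
  proof (cases "x \<in> ?H")
    case True
    have "orbit p x = orbit b x"
      using True b_in p(1) by (intro orbit_cong0[of x ?H]) (auto simp: permutes_in_image[OF p(1)] simp del: in_out_arcs_conv)
    then show ?thesis
      using single_cycle_orbit[OF p(1) finite_out_arcs p(2) True] embedding_vertex_cycle(2)[OF E True]
      by simp
  next
    case False
    show ?thesis
    proof (rule orbit_cong)
      show "x \<in> orbit (beta E) x" using pb by (rule permutation_self_in_orbit)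
      have ox: "orbit (beta E) x = out_arcs G (tail G x)"
        using x by (intro embedding_vertex_cycle(2)[OF E]) simp
      show "b s = beta E s" if "s \<in> orbit (beta E) x" for s
        using that ox False x b_out[of s] by simp
    qed
  qed
  then have "cycles_on b (arcs G) = cycles_on (beta E) (arcs G)" by (simp add: cycles_on_def)
  then have "is_embedding G arev E'" using E b by (simp add: is_embedding_def E'_def)
  moreover have "gamma E' = gamma E \<circ> \<tau>"
    by (simp add: E'_def b_def embedding_permutes(3)[OF E] comp_assoc)
  moreover have "s_at G E v \<circ> \<tau> = D_at G E v \<circ> p"
    by (simp add: D_at_def \<tau>_def comp_assoc)
  ultimately show ?thesis
    using card_cycles_on_local_change[OF embedding_permutes(2)[OF E] finite_arcs HA tau] loc(5)
    by (intro exI[of _ E']) (simp add: faces_def s_at_def)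
qed

lemma faces_nonempty: "0 < card (faces G E)"
  using arcs_nonempty by (simp add: faces_def cycles_on_def card_gt_0_iff)

lemma genus_le_betti:
  assumes "is_embedding G arev E"
  shows "genus G arev E \<le> betti G arev div 2"
  using two_genus[OF assms] faces_nonempty[of E] by (simp add: betti_def)

lemma finite_embeddings: "finite {E. is_embedding G arev E}"
proof (rule finite_subset)
  show "{E. is_embedding G arev E} \<subseteq> (\<lambda>b. \<lparr>alpha = arev, beta = b, gamma = arev \<circ> b\<rparr>) ` {b. b permutes arcs G}"
    by (auto simp: is_embedding_def intro!: image_eqI)
qed (simp add: finite_permutations)

text \<open>
  The required number of faces at \<open>v\<close> is \<open>k = q - 2 * \<Delta>g\<close>. It has the parity of
  \<open>q\<close>, which itself is the number of cycles of \<open>D\<close> times a full cycle.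
\<close>

theorem genus_interpolation:
  assumes E: "is_embedding G arev E" and v: "v \<in> verts G"
    and q: "q = int (card (incident_faces G E v))"
    and l: "l = int (card (cycles_on (D_at G E v) (out_arcs G v)))"
    and lower: "- ((int (out_degree G v) + 1 - l - q) div 2) \<le> \<Delta>g"
    and upper: "\<Delta>g \<le> (q - 1) div 2"
  shows "\<exists>E'. is_embedding G arev E' \<and> genus G arev E' = genus G arev E + \<Delta>g"
proof -
  let ?H = "out_arcs G v" and ?D = "D_at G E v"
  note loc = local_permutations[OF E v]
  define k where "k = nat (q - 2 * \<Delta>g)"
  have k: "int k = q - 2 * \<Delta>g" "1 \<le> k" using upper by (simp_all add: k_def)
  have "even (card (cycles_on (?D \<circ> pi_at G E v) ?H) + card (cycles_on ?D ?H)
      + card (cycles_on (pi_at G E v) ?H) + card ?H)"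
    by (rule parity_cycles_comp[OF loc(2,1) finite_out_arcs])
  then have "even (q + l + 1 + int (card ?H))" using loc(3,4,5) q l by simp
  then have par: "even (int k + l + int (card ?H) + 1)" using k(1) by presburger
  have le: "int k + l \<le> int (card ?H) + 1"
    using lower k(1) by (simp add: out_degree_def)
  obtain p where p: "p permutes ?H" "card (cycles_on p ?H) = 1" "card (cycles_on (?D \<circ> p) ?H) = k"
  proof -
    have "even (k + card (cycles_on ?D ?H) + card ?H + 1)" using par l by presburger
    moreover have "k + card (cycles_on ?D ?H) \<le> card ?H + 1" using le l by linarith
    ultimately show thesis
      using attain_cycle_count[OF loc(2) finite_out_arcs embedding_vertex_cycle(1)[OF E v] k(2)] that
      by blast
  qed
  obtain E' where E': "is_embedding G arev E'"
    "card (faces G E') + card (incident_faces G E v) = card (faces G E) + k"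
    using rotation_replacement[OF E v p(1,2)] p(3) by auto
  have "int (card (faces G E')) + q = int (card (faces G E)) + int k"
    using E'(2) q by linarith
  \<comment> \<open>Here \<open>2 * h = c - F\<close> is Euler's formula; \<open>c\<close> depends on \<open>G\<close> alone.\<close>
  moreover have "h' = h + d"
    if "F' + q = F + K" "2 * h = c - F" "2 * h' = c - F'" "K = q - 2 * d" for F F' K h h' c d :: int
    using that by presburger
  ultimately have "genus G arev E' = genus G arev E + \<Delta>g"
    using two_genus[OF E] two_genus[OF E'(1)] k(1) by blast
  then show ?thesis using E'(1) by blast
qed

text \<open>
  Going down from the given rotation leaves one or two faces, according to the parity of their
  number, and two faces instead of one is exactly what rounding \<open>betti G arev div 2\<close> accounts for.
\<close>

theorem upper_embeddableI:
  assumes E: "is_embedding G arev E" and v: "v \<in> verts G"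
    and all: "\<forall>F \<in> faces G E. face_incident G F v"
  shows "upper_embeddable G arev"
proof -
  let ?H = "out_arcs G v" and ?D = "D_at G E v"
  note loc = local_permutations[OF E v]
  have inc: "incident_faces G E v = faces G E" using all by (auto simp: incident_faces_def)
  let ?q = "card (faces G E)"
  define k where "k = (if even ?q then 2 else 1::nat)"
  have q: "card (cycles_on (?D \<circ> pi_at G E v) ?H) = ?q" using loc(4,5) inc by simp
  have "1 \<le> k" "k \<le> ?q" "even (?q + k)"
    using faces_nonempty[of E] by (auto simp: k_def elim: evenE)
  then obtain p where p: "p permutes ?H" "card (cycles_on p ?H) = 1" "card (cycles_on (?D \<circ> p) ?H) = k"
    using lower_cycle_count[OF loc(2) finite_out_arcs loc(1,3), of k] q by auto
  obtain E' where E': "is_embedding G arev E'" "card (faces G E') = k"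
    using rotation_replacement[OF E v p(1,2)] p(3) inc by auto
  have "genus G arev E' = betti G arev div 2"
    using two_genus[OF E'(1)] E'(2) by (auto simp: betti_def k_def split: if_splits)
  then have "max_genus G arev = betti G arev div 2"
    unfolding max_genus_def using finite_embeddings E'(1) genus_le_betti
    by (intro Max_eqI) (auto intro: rev_image_eqI)
  then show ?thesis by (simp add: upper_embeddable_def)
qed

end

theorem corollary4p6:
  fixes G :: "('a, 'h) pre_digraph" and arev :: "'h \<Rightarrow> 'h" and E :: "'h embedding"
  assumes "multigraph G arev"
    and "is_embedding G arev E"
  shows "(\<forall>v \<in> verts G. \<forall>q l. \<forall>\<Delta>g :: int.
            q = int (card (incident_faces G E v)) \<longrightarrow>
            l = int (size (cycle_type_on (D_at G E v) (out_arcs G v))) \<longrightarrow>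
            - ((int (out_degree G v) + 1 - l - q) div 2) \<le> \<Delta>g \<longrightarrow>
            \<Delta>g \<le> (q - 1) div 2 \<longrightarrow>
            (\<exists>E'. is_embedding G arev E' \<and> genus G arev E' = genus G arev E + \<Delta>g))
       \<and> ((\<exists>v \<in> verts G. \<forall>F \<in> faces G E. face_incident G F v) \<longrightarrow> upper_embeddable G arev)"
proof -
  interpret multigraph G arev by fact
  have "size (cycle_type_on f S) = card (cycles_on f S)" for f :: "'h \<Rightarrow> 'h" and S
    by (simp add: cycle_type_on_def)
  then show ?thesis
    using genus_interpolation[OF assms(2)] upper_embeddableI[OF assms(2)] by auto
qed

end
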